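(* Let $$a=x^2+y^2+z^2,\qquad b=x(y^2-z^2),\qquad c=\tfrac{1}{2^4}\left(9x^4-5x^2y^2+36y^4-5x^2z^2-68y^2z^2+36z^4\right),$$ and for $\tau\in\mathbb{R}$ put $\Delta_\tau:=ac-\tau b^2$. Let $\tau^*=4.92231255059\dots$ be the unique real root of the polynomial $m_t=36864t^3-213248t^2+317872t-794375$. Then for every real $\tau$ with $4.6875=\frac{5^2\cdot 3}{2^4}<\tau\le\tau^*$ one has $\Delta_\tau\in P_{3,6}\setminus\Sigma_{3,6}$. Moreover, for $\tau=\frac{5^2\cdot 3}{2^4}$ the form $\Delta_{\tau}$ is strictly positive on $\mathbb{R}^3\setminus\{0\}$ and belongs to the boundary $\partial\Sigma_{3,6}$ of the cone $\Sigma_{3,6}$.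
   Context: $P_{3,6}$ denotes the convex cone of real ternary sextic forms (homogeneous polynomials of degree $6$ in $x,y,z$) that are nonnegative on $\mathbb{R}^3$. $\Sigma_{3,6}\subseteq P_{3,6}$ denotes the subcone of those that are sums of squares of real polynomials. $\partial\Sigma_{3,6}$ is the topological boundary of $\Sigma_{3,6}$ in the $28$-dimensional real vector space of ternary sextic forms. *)

theory Defs
  imports
    "HOL-Analysis.Analysis"
    "HOL-Library.Poly_Mapping"
    "HOL-Computational_Algebra.Polynomial"
begin

text \<open>Elements of \<open>\<real>[x,y,z]\<close> are finitely supported maps from exponent vectors to coefficients.
  The three variables are indexed by the type \<open>3\<close>, so that points live in \<open>real ^ 3\<close>;
  note that \<open>3 = 0\<close> in this index type.\<close>

type_synonym tpoly = "(3 \<Rightarrow>\<^sub>0 nat) \<Rightarrow>\<^sub>0 real"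

definition Const :: "real \<Rightarrow> tpoly" where
  "Const r = Poly_Mapping.single 0 r"

definition Var :: "3 \<Rightarrow> tpoly" where
  "Var i = Poly_Mapping.single (Poly_Mapping.single i 1) 1"

definition eval :: "tpoly \<Rightarrow> real ^ 3 \<Rightarrow> real" where
  "eval p v = (\<Sum>m \<in> Poly_Mapping.keys p.
     Poly_Mapping.lookup p m * (\<Prod>i\<in>UNIV. v $ i ^ Poly_Mapping.lookup m i))"

definition forms :: "nat \<Rightarrow> tpoly set" where
  "forms d = {p. \<forall>m \<in> Poly_Mapping.keys p. (\<Sum>i\<in>UNIV. Poly_Mapping.lookup m i) = d}"

definition P3 :: "nat \<Rightarrow> tpoly set" where
  "P3 d = {p \<in> forms d. \<forall>v. eval p v \<ge> 0}"

definition Sigma3 :: "nat \<Rightarrow> tpoly set" where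
  "Sigma3 d = {p \<in> forms d. \<exists>(n::nat) (q :: nat \<Rightarrow> tpoly). p = (\<Sum>i<n. (q i)\<^sup>2)}"

text \<open>The Euclidean topology on the finite-dimensional space of forms of degree \<open>d\<close>, given by the
  coefficients: the topology on functions is that of pointwise convergence, and forms of degree
  \<open>d\<close> have their coefficients supported on a fixed finite set of exponent vectors.\<close>

definition form_topology :: "nat \<Rightarrow> tpoly topology" where
  "form_topology d = pullback_topology (forms d) Poly_Mapping.lookup euclidean"

definition a_form :: tpoly where
  "a_form = Var 1^2 + Var 2^2 + Var 3^2"

definition b_form :: tpoly where
  "b_form = Var 1 * (Var 2^2 - Var 3^2)"

definition c_form :: tpoly where
  "c_form = Const (1 / 2^4) *
     (9 * Var 1^4 - 5 * Var 1^2 * Var 2^2 + 36 * Var 2^4 - 5 * Var 1^2 * Var 3^2 - 68 * Var 2^2 * Var 3^2 + 36 * Var 3^4)"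

definition Delta :: "real \<Rightarrow> tpoly" where
  "Delta \<tau> = a_form * c_form - Const \<tau> * b_form^2"

definition m_poly :: "real poly" where
  "m_poly = [: -794375, 317872, -213248, 36864 :]"

definition tau_star :: real where
  "tau_star = (THE t. poly m_poly t = 0)"

end

theory Submission
  imports Defs
begin

text \<open>
  Every member of the family differs from the one at \<open>75/16\<close> by a multiple of a square:
  \<open>16 Delta \<tau> = cubic_x\<^sup>2 + 4 cubic_y\<^sup>2 + 4 cubic_z\<^sup>2 + (75 - 16 \<tau>) b_form\<^sup>2\<close>, where
  \<open>cubic_x = x (3 x\<^sup>2 - 2 y\<^sup>2 - 2 z\<^sup>2)\<close> and the other two cubics arise by permuting the variables
  (\<open>Delta_eq\<close>). At \<open>75/16\<close> this is a sum of squares, strictly positive because the three cubics have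
  no common real zero.

  That the form ceases to be a sum of squares beyond \<open>75/16\<close> is shown by a linear functional \<open>L\<close> on
  sextics: symmetric in the variables, with values \<open>8\<close>, \<open>6\<close>, \<open>3\<close> on \<open>x^6\<close>, \<open>x^4 y^2\<close>,
  \<open>x^2 y^2 z^2\<close> and \<open>0\<close> on monomials with an odd exponent. The quadratic form \<open>q \<mapsto> L (q\<^sup>2)\<close> on
  cubics is positive semidefinite, and its kernel is spanned by \<open>cubic_x\<close>, \<open>cubic_y\<close> and \<open>cubic_z\<close>.
  As \<open>L (b_form\<^sup>2) = 6\<close>, the value \<open>L (Delta \<tau>) = 6 (75/16 - \<tau>)\<close> is negative for
  \<open>\<tau> > 75/16\<close> (\<open>separator_Delta\<close>), whereas \<open>L\<close> is nonnegative on sums of squares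
  (\<open>separator_nonneg_on_Sigma3\<close>). The latter uses that the summands of a homogeneous sum of squares are
  themselves homogeneous (\<open>forms_sum_of_squares_D\<close>). Since \<open>Delta \<tau>\<close> depends continuously on \<open>\<tau>\<close>,
  the form at \<open>75/16\<close> lies on the boundary of the cone.

  Nonnegativity up to \<open>tau_star\<close> reduces to one variable. For fixed \<open>x\<close> and \<open>y\<^sup>2 + z\<^sup>2\<close> the
  form is affine in \<open>(y\<^sup>2 - z\<^sup>2)\<^sup>2\<close>, so it has to be checked only at the two extreme values of this
  quantity. At zero the form is nonnegative and does not depend on \<open>\<tau>\<close>; the other value gives the cubic
  \<open>9 X^3 + 4 X^2 + (31 - 16 \<tau>) X + 36\<close> on \<open>X \<ge> 0\<close>, and \<open>tau_star\<close> is the parameter at which this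
  cubic acquires a positive double root (\<open>tau_star_param\<close>, \<open>Delta_nonneg\<close>).
\<close>

section \<open>Linear functionals on polynomials\<close>

text \<open>Evaluation at a point, extraction of a coefficient and the separating functional below are all
  linear functionals that are determined by their values on monomials; this definition lets them share
  one computation of products.\<close>

definition lin_ext :: "((3 \<Rightarrow>\<^sub>0 nat) \<Rightarrow> real) \<Rightarrow> tpoly \<Rightarrow> real" where
  "lin_ext \<phi> p = (\<Sum>m\<in>Poly_Mapping.keys p. Poly_Mapping.lookup p m * \<phi> m)"

lemma lin_ext_superset:
  assumes "finite A" "Poly_Mapping.keys p \<subseteq> A"
  shows "lin_ext \<phi> p = (\<Sum>m\<in>A. Poly_Mapping.lookup p m * \<phi> m)"
  unfolding lin_ext_def using assms
  by (intro sum.mono_neutral_left) (auto simp: in_keys_iff)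

lemma lin_ext_zero [simp]: "lin_ext \<phi> 0 = 0"
  by (simp add: lin_ext_def)

lemma lin_ext_add [simp]: "lin_ext \<phi> (p + q) = lin_ext \<phi> p + lin_ext \<phi> q"
proof -
  let ?A = "Poly_Mapping.keys p \<union> Poly_Mapping.keys q"
  have "lin_ext \<phi> r = (\<Sum>m\<in>?A. Poly_Mapping.lookup r m * \<phi> m)" if "r \<in> {p, q, p + q}" for r
    using that keys_add[of p q] by (intro lin_ext_superset) auto
  then show ?thesis
    by (simp add: lookup_add sum.distrib distrib_right)
qed

lemma lin_ext_uminus [simp]: "lin_ext \<phi> (- p) = - lin_ext \<phi> p"
  using lin_ext_add[of \<phi> p "- p"] by simp

lemma lin_ext_diff [simp]: "lin_ext \<phi> (p - q) = lin_ext \<phi> p - lin_ext \<phi> q"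
  using lin_ext_add[of \<phi> p "- q"] by simp

lemma lin_ext_sum: "lin_ext \<phi> (\<Sum>i\<in>I. p i) = (\<Sum>i\<in>I. lin_ext \<phi> (p i))"
  by (induction I rule: infinite_finite_induct) auto

lemma lin_ext_single [simp]: "lin_ext \<phi> (Poly_Mapping.single m c) = c * \<phi> m"
  by (simp add: lin_ext_def)

lemma lookup_as_lin_ext: "Poly_Mapping.lookup p k = lin_ext (\<lambda>m. of_bool (m = k)) p"
  by (cases "k \<in> Poly_Mapping.keys p") (auto simp: lin_ext_def in_keys_iff of_bool_def if_distrib sum.delta cong: if_cong)

lemma poly_mapping_expansion:
  "p = (\<Sum>m\<in>Poly_Mapping.keys p. Poly_Mapping.single m (Poly_Mapping.lookup p m))"
  by (rule poly_mapping_eqI) (auto simp: lookup_sum lookup_single when_def in_keys_iff)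

lemma lin_ext_mult:
  "lin_ext \<phi> (p * q) = (\<Sum>m\<in>Poly_Mapping.keys p. \<Sum>n\<in>Poly_Mapping.keys q.
     Poly_Mapping.lookup p m * Poly_Mapping.lookup q n * \<phi> (m + n))"
proof -
  have "p * q = (\<Sum>m\<in>Poly_Mapping.keys p. \<Sum>n\<in>Poly_Mapping.keys q.
     Poly_Mapping.single (m + n) (Poly_Mapping.lookup p m * Poly_Mapping.lookup q n))"
    by (subst poly_mapping_expansion[of p], subst poly_mapping_expansion[of q])
       (simp add: sum_product mult_single)
  then show ?thesis
    by (simp add: lin_ext_sum)
qed

section \<open>Evaluation and homogeneity\<close>

lemma eval_lin_ext: "eval p v = lin_ext (\<lambda>m. \<Prod>i\<in>UNIV. v $ i ^ Poly_Mapping.lookup m i) p"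
  by (simp add: eval_def lin_ext_def)

lemma eval_add [simp]: "eval (p + q) v = eval p v + eval q v"
  and eval_diff [simp]: "eval (p - q) v = eval p v - eval q v"
  by (simp_all add: eval_lin_ext)

lemma eval_mult [simp]: "eval (p * q) v = eval p v * eval q v"
  unfolding eval_lin_ext lin_ext_mult
  by (simp add: lin_ext_def sum_product lookup_add power_add prod.distrib mult_ac)

lemma eval_Const [simp]: "eval (Const c) v = c"
  by (simp add: eval_lin_ext Const_def)

lemma eval_numeral [simp]: "eval (numeral k) v = numeral k"
  using eval_Const[of "numeral k" v] by (simp add: Const_def)

lemma eval_one [simp]: "eval 1 v = 1"
  using eval_Const[of 1 v] by (simp add: Const_def)

lemma eval_power [simp]: "eval (p ^ k) v = eval p v ^ k"
  by (induction k) auto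

lemma eval_Var [simp]: "eval (Var j) v = v $ j"
proof -
  have "(\<Prod>i\<in>UNIV. v $ i ^ (1 when j = i)) = (\<Prod>i\<in>UNIV. if i = j then v $ i else 1)"
    by (intro prod.cong) auto
  then show ?thesis
    by (simp add: eval_lin_ext Var_def lookup_single)
qed

abbreviation mdeg :: "(3 \<Rightarrow>\<^sub>0 nat) \<Rightarrow> nat" where
  "mdeg m \<equiv> \<Sum>i\<in>UNIV. Poly_Mapping.lookup m i"

lemma mdeg_add: "mdeg (m + n) = mdeg m + mdeg n"
  by (simp add: lookup_add sum.distrib)

lemma forms_add: "p \<in> forms d \<Longrightarrow> q \<in> forms d \<Longrightarrow> p + q \<in> forms d"
  using keys_add[of p q] by (auto simp: forms_def)

lemma forms_uminus: "p \<in> forms d \<Longrightarrow> - p \<in> forms d"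
  by (simp add: forms_def in_keys_iff)

lemma forms_diff: "p \<in> forms d \<Longrightarrow> q \<in> forms d \<Longrightarrow> p - q \<in> forms d"
  using forms_add[OF _ forms_uminus, of p d q] by simp

lemma forms_mult: "p \<in> forms d \<Longrightarrow> q \<in> forms e \<Longrightarrow> p * q \<in> forms (d + e)"
  using keys_mult[of p q] by (fastforce simp: forms_def mdeg_add)

lemma forms_Const: "Const c \<in> forms 0"
  by (simp add: forms_def Const_def)

lemma forms_numeral: "numeral k \<in> forms 0"
  using forms_Const[of "numeral k"] by (simp add: Const_def)

lemma forms_one: "1 \<in> forms 0"
  using forms_Const[of 1] by (simp add: Const_def)

lemma forms_Var: "Var i \<in> forms 1"
  by (simp add: forms_def Var_def lookup_single when_def)

lemma forms_power: "p \<in> forms d \<Longrightarrow> p ^ k \<in> forms (k * d)"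
  by (induction k) (auto simp: forms_one intro: forms_mult)

section \<open>Sums of squares that are homogeneous\<close>

text \<open>If \<open>m\<close> is a vertex of the union \<open>K\<close> of the supports, then \<open>2m\<close> arises in each square only
  as \<open>m + m\<close>. Its coefficient is therefore a sum of squares, and no cancellation between the summands
  is possible.\<close>

lemma lookup_sum_of_squares_vertex:
  fixes q :: "nat \<Rightarrow> tpoly"
  assumes vertex: "\<And>a b. a \<in> K \<Longrightarrow> b \<in> K \<Longrightarrow> a + b = m + m \<Longrightarrow> a = m \<and> b = m"
    and K: "\<And>i. i < n \<Longrightarrow> Poly_Mapping.keys (q i) \<subseteq> K"
  shows "Poly_Mapping.lookup (\<Sum>i<n. (q i)\<^sup>2) (m + m) = (\<Sum>i<n. (Poly_Mapping.lookup (q i) m)\<^sup>2)"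
proof -
  have "Poly_Mapping.lookup ((q i)\<^sup>2) (m + m) = (Poly_Mapping.lookup (q i) m)\<^sup>2" if "i < n" for i
  proof -
    have "of_bool (a + b = m + m) = of_bool (a = m) * (of_bool (b = m) :: real)"
      if "a \<in> Poly_Mapping.keys (q i)" "b \<in> Poly_Mapping.keys (q i)" for a b
      using vertex[of a b] K[OF \<open>i < n\<close>] that by auto
    then have "Poly_Mapping.lookup ((q i)\<^sup>2) (m + m) =
        (\<Sum>a\<in>Poly_Mapping.keys (q i). \<Sum>b\<in>Poly_Mapping.keys (q i).
          (Poly_Mapping.lookup (q i) a * of_bool (a = m)) * (Poly_Mapping.lookup (q i) b * of_bool (b = m)))"
      unfolding lookup_as_lin_ext[of _ "m + m"] power2_eq_square lin_ext_mult
      by (intro sum.cong refl) simp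
    also have "\<dots> = (Poly_Mapping.lookup (q i) m)\<^sup>2"
      unfolding lookup_as_lin_ext[of _ m] lin_ext_def power2_eq_square sum_product by (rule refl)
    finally show ?thesis .
  qed
  then show ?thesis
    by (simp add: lookup_sum)
qed

text \<open>The exponents of extreme degree that occur in the summands cannot cancel: the lexicographically
  largest exponent among those of maximal degree is a vertex, hence its double occurs in the sum and has
  degree \<open>2 * d\<close>. The same holds for the minimal degree, so every exponent has degree \<open>d\<close>.\<close>

lemma forms_sum_of_squares_D:
  fixes q :: "nat \<Rightarrow> tpoly"
  assumes form: "(\<Sum>i<n. (q i)\<^sup>2) \<in> forms (2 * d)" and "i < n"
  shows "q i \<in> forms d"
proof -
  define K where "K = (\<Union>i<n. Poly_Mapping.keys (q i))"
  have K: "finite K" "\<And>i. i < n \<Longrightarrow> Poly_Mapping.keys (q i) \<subseteq> K"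
    by (auto simp: K_def)
  have vertex_degree: "mdeg m = d"
    if "m \<in> K" and "\<And>a b. a \<in> K \<Longrightarrow> b \<in> K \<Longrightarrow> a + b = m + m \<Longrightarrow> a = m \<and> b = m" for m
  proof -
    obtain j where j: "j < n" "Poly_Mapping.lookup (q j) m \<noteq> 0"
      using \<open>m \<in> K\<close> by (auto simp: K_def in_keys_iff)
    then have "0 < (\<Sum>i<n. (Poly_Mapping.lookup (q i) m)\<^sup>2)"
      by (intro sum_pos2[of _ j]) auto
    also have "\<dots> = Poly_Mapping.lookup (\<Sum>i<n. (q i)\<^sup>2) (m + m)"
      by (rule lookup_sum_of_squares_vertex[symmetric, of K]) (fact that(2) K(2))+
    finally have "m + m \<in> Poly_Mapping.keys (\<Sum>i<n. (q i)\<^sup>2)"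
      by (simp only: in_keys_iff)
    then have "mdeg (m + m) = 2 * d"
      using form by (auto simp: forms_def)
    then show ?thesis
      unfolding mdeg_add by simp
  qed
  \<comment> \<open>The hypothesis on \<open>e\<close> says that the degree-\<open>e\<close> exponents form a face of \<open>K\<close>; a lexicographic
    maximum of a face is a vertex of \<open>K\<close>.\<close>
  have slice_degree: "e = d"
    if "K \<inter> {m. mdeg m = e} \<noteq> {}"
      and e: "\<And>a b. a \<in> K \<Longrightarrow> b \<in> K \<Longrightarrow> mdeg a + mdeg b = e + e \<Longrightarrow> mdeg a = e \<and> mdeg b = e" for e
  proof -
    let ?F = "K \<inter> {m. mdeg m = e}"
    have F: "finite ?F" using K by simp
    define m where "m = Max ?F"
    have m: "m \<in> ?F" unfolding m_def using F that(1) by (rule Max_in)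
    have "a = m \<and> b = m" if ab: "a \<in> K" "b \<in> K" "a + b = m + m" for a b
    proof -
      have "mdeg a = e \<and> mdeg b = e"
        using arg_cong[OF ab(3), of mdeg] m ab unfolding mdeg_add by (intro e) auto
      then have "a \<le> m" "b \<le> m"
        unfolding m_def using F ab by auto
      then show ?thesis
        using ab(3) by (metis add_le_cancel_left add_le_cancel_right add_mono order.antisym order.refl)
    qed
    then show ?thesis using vertex_degree[of m] m by auto
  qed
  have "mdeg m = d" if "m \<in> K" for m
  proof -
    let ?D = "mdeg ` K"
    have D: "finite ?D" "?D \<noteq> {}" using K that by auto
    have le: "Min ?D \<le> mdeg a" "mdeg a \<le> Max ?D" if "a \<in> K" for a
      using D that by auto
    have "Max ?D = d"
    proof (rule slice_degree)
      show "K \<inter> {m. mdeg m = Max ?D} \<noteq> {}" using Max_in[OF D] by fastforce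
    qed (use le in \<open>force dest: le(2)\<close>)
    moreover have "Min ?D = d"
    proof (rule slice_degree)
      show "K \<inter> {m. mdeg m = Min ?D} \<noteq> {}" using Min_in[OF D] by fastforce
    qed (use le in \<open>force dest: le(1)\<close>)
    ultimately show ?thesis using le[OF that] by simp
  qed
  then show ?thesis
    using K(2)[OF \<open>i < n\<close>] by (auto simp: forms_def)
qed

section \<open>A functional that separates from the sums of squares\<close>

abbreviation at_exponents :: "(nat \<Rightarrow> nat \<Rightarrow> nat \<Rightarrow> real) \<Rightarrow> (3 \<Rightarrow>\<^sub>0 nat) \<Rightarrow> real" where
  "at_exponents f m \<equiv> f (Poly_Mapping.lookup m 1) (Poly_Mapping.lookup m 2) (Poly_Mapping.lookup m 3)"

text \<open>These are the values of the separating functional \<open>L\<close> on \<open>x^i y^j z^k\<close> with \<open>i + j + k = 6\<close>. Up to a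
  factor they are the only ones, among those symmetric in the variables and zero on monomials with an odd
  exponent, for which the three cubics below lie in the kernel of the form \<open>q \<mapsto> L (q\<^sup>2)\<close>.\<close>

definition moment :: "nat \<Rightarrow> nat \<Rightarrow> nat \<Rightarrow> real" where
  "moment i j k = (if odd i \<or> odd j \<or> odd k then 0 
     else if 6 \<in> {i, j, k} then 8 else if 0 \<in> {i, j, k} then 6 else 3)"

definition separator :: "tpoly \<Rightarrow> real" where
  "separator = lin_ext (at_exponents moment)"

text \<open>On cubics the form \<open>q \<mapsto> L (q\<^sup>2)\<close> splits according to the parity of the exponents. On
  \<open>\<alpha> x^3 + \<beta> x y^2 + \<gamma> x z^2\<close> it equals
  \<open>1/2 (4\<alpha> + 3\<beta> + 3\<gamma>)\<^sup>2 + 3/2 (\<beta> - \<gamma>)\<^sup>2\<close>, and likewise for the other two variables, while on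
  \<open>\<delta> x y z\<close> it equals \<open>3 \<delta>\<^sup>2\<close>. The three functions below give the linear forms that are squared
  here; for exponents of total degree 3, \<open>i = 1\<close> and \<open>j\<close> even means that \<open>(j, k)\<close> is \<open>(2, 0)\<close> or
  \<open>(0, 2)\<close>.\<close>

definition odd_sum :: "nat \<Rightarrow> nat \<Rightarrow> nat \<Rightarrow> real" where
  "odd_sum i j k = (if i = 3 then 4 else if i = 1 \<and> even j then 3 else 0)"

definition odd_diff :: "nat \<Rightarrow> nat \<Rightarrow> nat \<Rightarrow> real" where
  "odd_diff i j k = (if i = 1 then (real j - real k) / 2 else 0)"

definition odd_xyz :: "nat \<Rightarrow> nat \<Rightarrow> nat \<Rightarrow> real" where
  "odd_xyz i j k = (if i = 1 \<and> j = 1 then 1 else 0)"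

text \<open>The weighted linear forms of the resulting diagonalization of \<open>q \<mapsto> L (q\<^sup>2)\<close>, of rank 7 on the
  10-dimensional space of cubics.\<close>

definition gram :: "(real \<times> (nat \<Rightarrow> nat \<Rightarrow> nat \<Rightarrow> real)) list" where
  "gram = [(1/2, odd_sum), (1/2, \<lambda>i j k. odd_sum j k i), (1/2, \<lambda>i j k. odd_sum k i j),
     (3/2, odd_diff), (3/2, \<lambda>i j k. odd_diff j k i), (3/2, \<lambda>i j k. odd_diff k i j), (3, odd_xyz)]"

text \<open>The diagonalization, checked on each of the \<open>10 \<times> 10\<close> pairs of cubic monomials.\<close>

lemma moment_gram:
  assumes "i + j + k = 3" "i' + j' + k' = 3"
  shows "moment (i + i') (j + j') (k + k') = (\<Sum>(w, f)\<leftarrow>gram. w * (f i j k * f i' j' k'))"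
proof -
  have cubic: "(i, j, k) \<in> {(3,0,0), (0,3,0), (0,0,3), (2,1,0), (2,0,1), (1,2,0), (0,2,1), (1,0,2), (0,1,2), (1,1,1)}"
    if "i + j + k = 3" for i j k :: nat
  proof -
    have "i = 0 \<or> i = 1 \<or> i = 2 \<or> i = 3" "j = 0 \<or> j = 1 \<or> j = 2 \<or> j = 3" and k: "k = 3 - i - j"
      using that by linarith+
    then show ?thesis
      using that unfolding k by (elim disjE) simp_all
  qed
  show ?thesis
    using cubic[OF assms(1)] cubic[OF assms(2)]
    by (simp only: insert_iff empty_iff prod.inject, elim disjE conjE FalseE; simp add: gram_def moment_def odd_sum_def odd_diff_def odd_xyz_def)
qed

lemma separator_square:
  assumes "q \<in> forms 3"
  shows "separator (q\<^sup>2) = (\<Sum>(w, f)\<leftarrow>gram. w * (lin_ext (at_exponents f) q)\<^sup>2)"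
proof -
  let ?K = "Poly_Mapping.keys q" and ?c = "Poly_Mapping.lookup q"
  have "separator (q\<^sup>2) = (\<Sum>m\<in>?K. \<Sum>n\<in>?K. ?c m * ?c n *
      (\<Sum>(w, f)\<leftarrow>gram. w * (at_exponents f m * at_exponents f n)))"
    unfolding separator_def power2_eq_square lin_ext_mult
    using assms by (intro sum.cong refl) (simp add: lookup_add moment_gram forms_def sum_3)
  also have "\<dots> = (\<Sum>m\<in>?K. \<Sum>n\<in>?K. 
      (\<Sum>(w, f)\<leftarrow>gram. w * ((?c m * at_exponents f m) * (?c n * at_exponents f n))))"
    by (simp add: gram_def algebra_simps)
  also have "\<dots> = (\<Sum>(w, f)\<leftarrow>gram. w * (\<Sum>m\<in>?K. \<Sum>n\<in>?K. (?c m * at_exponents f m) * (?c n * at_exponents f n)))"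
    by (simp add: gram_def sum.distrib sum_distrib_left)
  also have "\<dots> = (\<Sum>(w, f)\<leftarrow>gram. w * (lin_ext (at_exponents f) q)\<^sup>2)"
    by (simp only: lin_ext_def power2_eq_square sum_product)
  finally show ?thesis .
qed

lemma separator_nonneg_on_Sigma3:
  assumes "p \<in> Sigma3 6"
  shows "separator p \<ge> 0"
proof -
  obtain n and q :: "nat \<Rightarrow> tpoly" where p: "p = (\<Sum>i<n. (q i)\<^sup>2)" and "p \<in> forms (2 * 3)"
    using assms by (auto simp: Sigma3_def)
  then have "q i \<in> forms 3" if "i < n" for i
    using forms_sum_of_squares_D[of q n 3 i] that by simp
  then have "separator ((q i)\<^sup>2) \<ge> 0" if "i < n" for i
    using that by (simp add: separator_square gram_def)
  then show ?thesis
    unfolding p separator_def lin_ext_sum by (auto intro: sum_nonneg)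
qed

section \<open>The family of sextics\<close>

definition cubic_x :: tpoly where
  "cubic_x = Var 1 * (3 * Var 1^2 - 2 * Var 2^2 - 2 * Var 3^2)"

definition cubic_y :: tpoly where
  "cubic_y = Var 2 * (3 * Var 2^2 - 2 * Var 1^2 - 2 * Var 3^2)"

definition cubic_z :: tpoly where
  "cubic_z = Var 3 * (3 * Var 3^2 - 2 * Var 1^2 - 2 * Var 2^2)"

lemma Const_diff: "Const (r - s) = Const r - Const s"
  and Const_mult: "Const (r * s) = Const r * Const s"
  and Const_numeral: "Const (numeral k) = numeral k"
  by (simp_all add: Const_def single_diff mult_single)

text \<open>\<open>Delta \<tau>\<close> is even in each variable, so a Gram matrix for it may be taken block diagonal with
  respect to the parity of the exponents. At \<open>75/16\<close> the blocks of the cubics odd in only one of the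
  variables have rank one, which gives one square each, and the block of \<open>x y z\<close> vanishes.\<close>

lemma Delta_eq:
  "Delta \<tau> = Const (1/16) * (cubic_x\<^sup>2 + 4 * cubic_y\<^sup>2 + 4 * cubic_z\<^sup>2) + Const (75/16 - \<tau>) * b_form\<^sup>2"
proof -
  have id: "(x\<^sup>2 + y\<^sup>2 + z\<^sup>2) * (C * (9 * x^4 - 5 * x^2 * y^2 + 36 * y^4 - 5 * x^2 * z^2 - 68 * y^2 * z^2 + 36 * z^4))
      - T * (x * (y\<^sup>2 - z\<^sup>2))\<^sup>2
    = C * ((x * (3 * x^2 - 2 * y^2 - 2 * z^2))\<^sup>2 + 4 * (y * (3 * y^2 - 2 * x^2 - 2 * z^2))\<^sup>2
        + 4 * (z * (3 * z^2 - 2 * x^2 - 2 * y^2))\<^sup>2) + (C * 75 - T) * (x * (y\<^sup>2 - z\<^sup>2))\<^sup>2"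
    for x y z C T :: tpoly
    by algebra
  have "Const (75/16 - \<tau>) = Const (1/16) * 75 - Const \<tau>"
    using Const_mult[of "1/16" 75] by (simp add: Const_diff Const_numeral)
  then show ?thesis
    unfolding Delta_def a_form_def b_form_def c_form_def cubic_x_def cubic_y_def cubic_z_def
    using id[of "Var 1" "Var 2" "Var 3" "Const (1/16)" "Const \<tau>"] by simp
qed

lemma cubics_are_forms: "cubic_x \<in> forms 3" "cubic_y \<in> forms 3" "cubic_z \<in> forms 3" "b_form \<in> forms 3"
proof -
  have sq: "Var i ^ 2 \<in> forms 2" "numeral k * Var i ^ 2 \<in> forms 2" for i k
    using forms_power[OF forms_Var, of i 2] forms_mult[OF forms_numeral[of k] forms_power[OF forms_Var, of i 2]]
    by (simp_all only: mult_1_right add_0_left)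
  have "Var i * q \<in> forms 3" if "q \<in> forms 2" for i q
    using forms_mult[OF forms_Var that] by (simp add: numeral_3_eq_3)
  then show "cubic_x \<in> forms 3" "cubic_y \<in> forms 3" "cubic_z \<in> forms 3" "b_form \<in> forms 3"
    unfolding cubic_x_def cubic_y_def cubic_z_def b_form_def by (simp_all add: sq forms_diff)
qed

lemma lin_ext_Const_mult: "lin_ext \<phi> (Const c * p) = c * lin_ext \<phi> p"
  by (subst poly_mapping_expansion[of p])
     (simp add: Const_def sum_distrib_left mult_single lin_ext_sum, simp add: lin_ext_def sum_distrib_left mult.assoc)

lemma lin_ext_numeral_mult: "lin_ext \<phi> (numeral k * p) = numeral k * lin_ext \<phi> p"
  using lin_ext_Const_mult[of \<phi> "numeral k" p] by (simp add: Const_numeral)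

lemma lin_ext_monomial:
  "lin_ext \<phi> (Var i * (numeral k * Var j ^ 2)) = numeral k * \<phi> (Poly_Mapping.single i 1 + (Poly_Mapping.single j 2))"
  "lin_ext \<phi> (Var i * Var j ^ 2) = \<phi> (Poly_Mapping.single i 1 + (Poly_Mapping.single j 2))"
proof -
  show "lin_ext \<phi> (Var i * Var j ^ 2) = \<phi> (Poly_Mapping.single i 1 + (Poly_Mapping.single j 2))"
    by (simp add: Var_def power2_eq_square mult_single flip: single_add numeral_2_eq_2)
  then show "lin_ext \<phi> (Var i * (numeral k * Var j ^ 2)) = numeral k * \<phi> (Poly_Mapping.single i 1 + (Poly_Mapping.single j 2))"
    by (simp add: lin_ext_numeral_mult mult.left_commute[of "Var i"])
qed

lemma separator_values:
  "separator (cubic_x\<^sup>2) = 0" "separator (cubic_y\<^sup>2) = 0" "separator (cubic_z\<^sup>2) = 0" "separator (b_form\<^sup>2) = 6"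
  by (simp_all add: separator_square cubics_are_forms gram_def,
      simp_all add: cubic_x_def cubic_y_def cubic_z_def b_form_def right_diff_distrib lin_ext_monomial
        lookup_add lookup_single when_def odd_sum_def odd_diff_def odd_xyz_def)

text \<open>The functional vanishes on the three squares in \<open>Delta_eq\<close>, so it sees only the multiple of
  \<open>b_form\<^sup>2\<close> and changes sign exactly at \<open>75/16\<close>.\<close>

lemma separator_Delta: "separator (Delta \<tau>) = 6 * (75/16 - \<tau>)"
proof -
  have "separator (Delta \<tau>) = 1/16 * (separator (cubic_x\<^sup>2) + 4 * separator (cubic_y\<^sup>2) + 4 * separator (cubic_z\<^sup>2))
     + (75/16 - \<tau>) * separator (b_form\<^sup>2)"
    by (simp only: Delta_eq separator_def lin_ext_add lin_ext_Const_mult lin_ext_numeral_mult)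
  then show ?thesis by (simp add: separator_values)
qed

lemma Delta_form: "Delta \<tau> \<in> forms 6"
proof -
  have sq: "Const r * p\<^sup>2 \<in> forms 6" "numeral k * p\<^sup>2 \<in> forms 6" "p\<^sup>2 \<in> forms 6" if "p \<in> forms 3" for r k p
    using forms_mult[OF forms_Const[of r] forms_power[OF that, of 2]]
      forms_mult[OF forms_numeral[of k] forms_power[OF that, of 2]] forms_power[OF that, of 2]
    by simp_all
  have "cubic_x\<^sup>2 + 4 * cubic_y\<^sup>2 + 4 * cubic_z\<^sup>2 \<in> forms 6"
    by (intro forms_add sq cubics_are_forms)
  from forms_mult[OF forms_Const this, of "1/16"] show ?thesis
    unfolding Delta_eq using sq(1)[OF cubics_are_forms(4)] by (simp add: forms_add)
qed

lemma Delta_not_Sigma3: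
  assumes "75/16 < \<tau>"
  shows "Delta \<tau> \<notin> Sigma3 6"
  using separator_nonneg_on_Sigma3[of "Delta \<tau>"] assms by (auto simp: separator_Delta)

lemma Delta_in_Sigma3: "Delta (75/16) \<in> Sigma3 6"
proof -
  define q where "q i = (if i = 0 then Const (1/4) * cubic_x else if i = 1 then Const (1/2) * cubic_y
     else Const (1/2) * cubic_z)" for i :: nat
  have c: "(Const (1/4))\<^sup>2 = Const (1/16)" "(Const (1/2))\<^sup>2 = Const (1/16) * 4"
    using Const_mult[of "1/4" "1/4"] Const_mult[of "1/2" "1/2"] Const_mult[of "1/16" 4] 
    by (simp_all add: power2_eq_square Const_numeral)
  have "Const 0 = 0" by (simp add: Const_def)
  then have "Delta (75/16) = (\<Sum>i<3. (q i)\<^sup>2)"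
    by (simp add: Delta_eq q_def numeral_3_eq_3 power_mult_distrib c distrib_left mult.assoc)
  then show ?thesis
    using Delta_form unfolding Sigma3_def by blast
qed

text \<open>The coefficients of \<open>Delta \<tau>\<close> are continuous in \<open>\<tau>\<close>, and \<open>Delta \<tau>\<close> leaves the cone as
  soon as \<open>\<tau>\<close> exceeds \<open>75/16\<close>.\<close>

lemma Delta_frontier: "Delta (75/16) \<in> form_topology 6 frontier_of Sigma3 6"
proof -
  have top: "topspace (form_topology 6) = forms 6"
    by (simp add: form_topology_def topspace_pullback_topology)
  have "Delta (75/16) \<in> form_topology 6 closure_of Sigma3 6"
    using Delta_in_Sigma3 closure_of_subset[of "Sigma3 6" "form_topology 6"] top
    by (auto simp: Sigma3_def)
  moreover have "Delta (75/16) \<notin> form_topology 6 interior_of Sigma3 6"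
  proof
    assume "Delta (75/16) \<in> form_topology 6 interior_of Sigma3 6"
    then obtain W where W: "open W" "Poly_Mapping.lookup (Delta (75/16)) \<in> W"
      and sub: "Poly_Mapping.lookup -` W \<inter> forms 6 \<subseteq> Sigma3 6"
      by (auto simp: interior_of_def form_topology_def openin_pullback_topology)
    have affine: "Poly_Mapping.lookup (Delta \<tau>) m =
        Poly_Mapping.lookup (a_form * c_form) m - \<tau> * Poly_Mapping.lookup (b_form\<^sup>2) m" for \<tau> m
      unfolding Delta_def lookup_as_lin_ext[of _ m] by (simp add: lin_ext_Const_mult)
    have "continuous_on UNIV (\<lambda>\<tau>. Poly_Mapping.lookup (Delta \<tau>) m)" for m
      unfolding affine by (intro continuous_intros)
    then have "continuous_on UNIV (\<lambda>\<tau>. Poly_Mapping.lookup (Delta \<tau>))"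
      by (rule continuous_on_coordinatewise_then_product)
    then have "open ((\<lambda>\<tau>. Poly_Mapping.lookup (Delta \<tau>)) -` W)"
      using W(1) by (rule open_vimage[rotated])
    then obtain e where e: "e > 0" "ball (75/16) e \<subseteq> (\<lambda>\<tau>. Poly_Mapping.lookup (Delta \<tau>)) -` W"
      using W(2) unfolding open_contains_ball by (metis vimageI)
    have "75/16 + e/2 \<in> ball (75/16) e"
      using e(1) by (simp add: dist_real_def)
    then have "Delta (75/16 + e/2) \<in> Sigma3 6"
      using subsetD[OF e(2)] subsetD[OF sub] Delta_form by blast
    then show False
      using Delta_not_Sigma3 e(1) by simp
  qed
  ultimately show ?thesis
    by (simp add: frontier_of_def)
qed

text \<open>The three cubics have no common real zero: if \<open>k\<close> of the coordinates are nonzero and \<open>T\<close> is the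
  sum of their squares, each of these squares is \<open>2T/5\<close>, whence \<open>T = 2kT/5\<close>; as \<open>k\<close> is an integer,
  \<open>T = 0\<close>.\<close>

lemma Delta_strictly_positive:
  assumes "v \<noteq> 0"
  shows "eval (Delta (75/16)) v > 0"
proof -
  define x y z where "x = v $ 1" and "y = v $ 2" and "z = v $ 3"
  define f g h where "f = x * (3 * x\<^sup>2 - 2 * y\<^sup>2 - 2 * z\<^sup>2)" and "g = y * (3 * y\<^sup>2 - 2 * x\<^sup>2 - 2 * z\<^sup>2)"
    and "h = z * (3 * z\<^sup>2 - 2 * x\<^sup>2 - 2 * y\<^sup>2)"
  have eval: "eval (Delta (75/16)) v = (f\<^sup>2 + 4 * g\<^sup>2 + 4 * h\<^sup>2) / 16"
    unfolding Delta_eq by (simp add: cubic_x_def cubic_y_def cubic_z_def f_def g_def h_def x_def y_def z_def)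
  have "f \<noteq> 0 \<or> g \<noteq> 0 \<or> h \<noteq> 0"
  proof (rule ccontr)
    assume "\<not> ?thesis"
    then have zero: "x\<^sup>2 = 0 \<or> 3 * x\<^sup>2 = 2 * y\<^sup>2 + 2 * z\<^sup>2" "y\<^sup>2 = 0 \<or> 3 * y\<^sup>2 = 2 * x\<^sup>2 + 2 * z\<^sup>2"
        "z\<^sup>2 = 0 \<or> 3 * z\<^sup>2 = 2 * x\<^sup>2 + 2 * y\<^sup>2"
      by (auto simp: f_def g_def h_def)
    have "x\<^sup>2 \<ge> 0" "y\<^sup>2 \<ge> 0" "z\<^sup>2 \<ge> 0" by simp_all
    with zero have "x\<^sup>2 = 0 \<and> y\<^sup>2 = 0 \<and> z\<^sup>2 = 0" by argo
    then show False
      using assms by (simp add: x_def y_def z_def vec_eq_iff forall_3)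
  qed
  then have "f\<^sup>2 + 4 * g\<^sup>2 + 4 * h\<^sup>2 > 0"
    using zero_less_power2[of f] zero_less_power2[of g] zero_less_power2[of h]
      zero_le_power2[of f] zero_le_power2[of g] zero_le_power2[of h] by argo
  then show ?thesis unfolding eval by simp
qed

section \<open>Nonnegativity up to the critical parameter\<close>

lemma m_poly_eval: "poly m_poly t = 36864 * t^3 - 213248 * t^2 + 317872 * t - 794375"
  by (simp add: m_poly_def algebra_simps power2_eq_square power3_eq_cube)

lemma m_poly_root_bounds: "\<exists>t. 4.92231255059 \<le> t \<and> t < 4.92231255060 \<and> poly m_poly t = 0"
proof -
  have "\<exists>t>4.92231255059. t < 4.92231255060 \<and> poly m_poly t = 0"
    by (rule poly_IVT_pos) (simp_all add: m_poly_eval power2_eq_square power3_eq_cube)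
  then show ?thesis by (meson less_imp_le)
qed

lemma m_poly_unique_root: "\<exists>!t. poly m_poly t = 0"
proof -
  obtain r where "4.92231255059 \<le> r" and root: "poly m_poly r = 0"
    using m_poly_root_bounds by blast
  then have r: "r \<ge> 4" by simp
  have "t = r" if "poly m_poly t = 0" for t
  proof (rule ccontr)
    assume "t \<noteq> r"
    have "(t - r) * (36864 * (t\<^sup>2 + t * r + r\<^sup>2) - 213248 * (t + r) + 317872) = 0"
      using that root unfolding m_poly_eval by algebra
    with \<open>t \<noteq> r\<close> have "36864 * (t\<^sup>2 + t * r + r\<^sup>2) - 213248 * (t + r) + 317872 = 0" by simp
    \<comment> \<open>Completing the square in \<open>t\<close> leaves a polynomial in \<open>r\<close> that is positive because \<open>r \<ge> 4\<close>.\<close>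
    moreover have "36864 * (t\<^sup>2 + t * r + r\<^sup>2) - 213248 * (t + r) + 317872 =
        36864 * (t + r/2 - 833/288)\<^sup>2 + r * (27648 * r - 106624) + 85292/9"
      by (simp add: field_simps power2_eq_square)
    moreover have "r * (27648 * r - 106624) \<ge> 0"
      using r by simp
    moreover have "36864 * (t + r/2 - 833/288)\<^sup>2 \<ge> 0"
      by simp
    ultimately show False by linarith
  qed
  with root show ?thesis by blast
qed

lemma tau_star_root: "poly m_poly tau_star = 0"
  unfolding tau_star_def by (rule theI'[OF m_poly_unique_root])

lemma tau_star_eqI: "poly m_poly t = 0 \<Longrightarrow> t = tau_star"
  using m_poly_unique_root tau_star_root by blast

lemma tau_star_bounds: "4.92231255059 \<le> tau_star" "tau_star < 4.92231255060"
  using m_poly_root_bounds tau_star_eqI by blast+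

text \<open>On the points with \<open>z = 0\<close> and \<open>y = 1\<close>, nonnegativity of \<open>16 Delta \<tau>\<close> amounts to
  \<open>9 X^3 + 4 X^2 + (31 - 16 \<tau>) X + 36 \<ge> 0\<close> for all \<open>X = x^2\<close>. The critical \<open>\<tau>\<close> is
  the minimum over \<open>X > 0\<close> of the value of \<open>\<tau>\<close> for which \<open>X\<close> is a root of this cubic. The minimum is
  attained at the root \<open>s\<close> of \<open>9 s^3 + 2 s^2 = 18\<close>, which is a double root of the critical cubic, and
  \<open>m_poly\<close> is obtained by eliminating \<open>s\<close>.\<close>

lemma tau_star_param:
  obtains s where "s > 0" "9 * s^3 + 2 * s^2 = 18" "16 * tau_star = 31 + 8 * s + 27 * s^2"
proof -
  have "\<exists>s>1. s < 2 \<and> poly [:-18, 0, 2, 9 :: real:] s = 0"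
    by (rule poly_IVT_pos) simp_all
  then obtain s :: real where s: "s > 1" "9 * s^3 + 2 * s^2 = 18"
    by (auto simp: algebra_simps power2_eq_square power3_eq_cube)
  define t where "t = (31 + 8 * s + 27 * s^2) / 16"
  have "16 * t = 31 + 8 * s + 27 * s^2" by (simp add: t_def)
  have "poly m_poly t = (9 * s^3 + 2 * s^2 - 18) * (19683 * s^3 + 13122 * s^2 + 2592 * s + 39494)"
    unfolding m_poly_eval t_def by (simp add: field_simps power2_eq_square power3_eq_cube)
  with s(2) have "t = tau_star" by (simp add: tau_star_eqI)
  then show ?thesis using that[of s] s by (simp add: t_def)
qed

text \<open>For fixed \<open>x\<close> and fixed \<open>S = y^2 + z^2\<close> the form is affine in \<open>D\<^sup>2\<close>, where
  \<open>D = y^2 - z^2\<close> and \<open>0 \<le> D\<^sup>2 \<le> S\<^sup>2\<close>. It therefore suffices to bound the values \<open>P\<close> and \<open>N\<close>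
  of \<open>16 Delta \<tau>\<close> at \<open>D = 0\<close> and at \<open>D\<^sup>2 = S\<^sup>2\<close>. The second is the homogenized cubic of \<open>tau_star_param\<close>.\<close>

lemma Delta_nonneg:
  assumes "\<tau> \<le> tau_star"
  shows "eval (Delta \<tau>) v \<ge> 0"
proof -
  obtain s where s: "s > 0" "9 * s^3 + 2 * s^2 = 18" "16 * tau_star = 31 + 8 * s + 27 * s^2"
    by (rule tau_star_param)
  define x y z where "x = v $ 1" and "y = v $ 2" and "z = v $ 3"
  define X S D where "X = x\<^sup>2" and "S = y\<^sup>2 + z\<^sup>2" and "D = y\<^sup>2 - z\<^sup>2"
  have nonneg: "X \<ge> 0" "S \<ge> 0" by (simp_all add: X_def S_def)
  define P where "P = (X + S) * (9 * X\<^sup>2 - 5 * X * S + S\<^sup>2)"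
  define N where "N = (X - s * S)\<^sup>2 * (9 * X + (18 * s + 4) * S) + 16 * (tau_star - \<tau>) * X * S\<^sup>2"
  have eval: "16 * eval (Delta \<tau>) v = P + D\<^sup>2 * (35 * (X + S) - 16 * \<tau> * X)"
    unfolding Delta_def a_form_def b_form_def c_form_def P_def X_def S_def D_def x_def y_def z_def
    by (simp, algebra)
  have "9 * X\<^sup>2 - 5 * X * S + S\<^sup>2 = (3 * X - 5/6 * S)\<^sup>2 + 11/36 * S\<^sup>2"
    by algebra
  then have "P \<ge> 0"
    using nonneg by (simp add: P_def)
  have "N \<ge> 0"
    using nonneg s(1) assms by (simp add: N_def)
  have "S\<^sup>2 - D\<^sup>2 = 4 * (y\<^sup>2 * z\<^sup>2)"
    unfolding S_def D_def by algebra
  then have "S\<^sup>2 - D\<^sup>2 \<ge> 0" by simp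
  have N: "N = P + S\<^sup>2 * (35 * (X + S) - 16 * \<tau> * X)"
  proof -
    have "N = 9 * X^3 + 4 * X\<^sup>2 * S + (16 * tau_star - 27 * s\<^sup>2 - 8 * s - 16 * \<tau>) * (X * S\<^sup>2)
        + (2 * (9 * s^3 + 2 * s\<^sup>2)) * S^3"
      unfolding N_def by algebra
    also have "\<dots> = 9 * X^3 + 4 * X\<^sup>2 * S + (31 - 16 * \<tau>) * (X * S\<^sup>2) + 36 * S^3"
      using s(2,3) by simp
    also have "\<dots> = P + S\<^sup>2 * (35 * (X + S) - 16 * \<tau> * X)"
      unfolding P_def by algebra
    finally show ?thesis .
  qed
  have "S\<^sup>2 * (16 * eval (Delta \<tau>) v) = (S\<^sup>2 - D\<^sup>2) * P + D\<^sup>2 * N"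
    unfolding eval N by algebra
  also have "\<dots> \<ge> 0"
    using \<open>S\<^sup>2 - D\<^sup>2 \<ge> 0\<close> \<open>P \<ge> 0\<close> \<open>N \<ge> 0\<close> by simp
  finally have *: "S\<^sup>2 * (16 * eval (Delta \<tau>) v) \<ge> 0" .
  show ?thesis
  proof (cases "S = 0")
    case True
    then have "y\<^sup>2 = 0" "z\<^sup>2 = 0"
      by (simp_all add: S_def add_nonneg_eq_0_iff)
    then have "D = 0" by (simp add: D_def)
    then show ?thesis using eval \<open>P \<ge> 0\<close> by simp
  next
    case False
    then show ?thesis using * by (simp add: zero_le_mult_iff)
  qed
qed

theorem theorem10:
  shows "(\<exists>!t. poly m_poly t = 0)
    \<and> 4.92231255059 \<le> tau_star \<and> tau_star < 4.92231255060
    \<and> (\<forall>\<tau>. 5^2 * 3 / 2^4 < \<tau> \<and> \<tau> \<le> tau_star \<longrightarrow> Delta \<tau> \<in> P3 6 - Sigma3 6)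
    \<and> (\<forall>v. v \<noteq> 0 \<longrightarrow> eval (Delta (5^2 * 3 / 2^4)) v > 0)
    \<and> Delta (5^2 * 3 / 2^4) \<in> form_topology 6 frontier_of Sigma3 6"
proof -
  have c: "5^2 * 3 / 2^4 = (75/16 :: real)" by simp
  show ?thesis
    unfolding c P3_def
    using m_poly_unique_root tau_star_bounds Delta_nonneg Delta_form Delta_not_Sigma3
      Delta_strictly_positive Delta_frontier
    by blast
qed

end
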